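(* Let $S$ be any semitopological semigroup. Then for every $k\in\mathbb{N}$ the algebra $W_k(S)$ is an $m$-admissible subalgebra of $C(S)$ contained in $D(S)$, and the algebra $W(S)$ is also an $m$-admissible subalgebra of $C(S)$ contained in $D(S)$.
   Context: $\mathbb{N}=\{1,2,\dots\}$. A semitopological semigroup is a semigroup $S$ with a topology for which all left translations $l_s(t)=st$ and right translations $r_t(s)=st$ are continuous. $C(S)$ is the $C^*$-algebra of bounded continuous complex-valued functions on $S$ with the sup norm; $L_sf=f\circ l_s$, $R_sf=f\circ r_s$. A unital $C^*$-subalgebra $F$ of $C(S)$ is left translation invariant if $L_sf\in F$ for all $s\in S$, $f\in F$; it is $m$-admissible if moreover for all $f\in F$ and all $\mu\in S^F$ (the spectrum of $F$, i.e. the nonzero multiplicative linear functionals on $F$) the function $T_\mu f$, $(T_\mu f)(s)=\mu(L_sf)$, belongs to $F$. In that case $S^F$ with the product $\mu\nu=\mu\circ T_\nu$ and the Gelfand topology is a compact Hausdorff right topological semigroup. $LMC(S)$ is the set of $f\in C(S)$ such that $s\mapsto\mu(L_sf)$ is continuous on $S$ for every $\mu$ in the spectrum of $C(S)$; it is an $m$-admissible subalgebra. Put $\Sigma=\{T_\mu: LMC(S)\to LMC(S)\;:\;\mu\in S^{LMC}\}$, a semigroup under composition. $D(S)$, the set of distal functions on $S$, consists of all $f\in LMC(S)$ with $\varepsilon(\sigma(f))=\sigma(f)$ for every $\sigma\in\Sigma$ and every idempotent $\varepsilon\in\Sigma$. Let $F_0$ be the set of constant functions on $S$ of modulus $1$,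 and inductively for $k\ge 1$ let $$F_k=\{f\in LMC(S): |f|=1 \text{ and for every }\sigma\in\Sigma \text{ there is } f_\sigma\in F_{k-1}\text{ with }\sigma(f)=f_\sigma f\},$$ where $|f|=1$ means $|f(s)|=1$ for all $s\in S$. Let $W_k(S)$ and $W(S)$ be the norm closures in $C(S)$ of the (complex) algebras generated by $F_k$ and by $\bigcup_{k\in\mathbb{N}}F_k$, respectively. *)

theory Defs
  imports "HOL-Analysis.Analysis"
begin

class semitopological_semigroup = topological_space + semigroup_mult +
  assumes open_vimage_left_translation: "open U \<Longrightarrow> open ((\<lambda>t. s * t) -` U)"
    and open_vimage_right_translation: "open U \<Longrightarrow> open ((\<lambda>s. s * t) -` U)"

lemma continuous_on_left_translation:
  "continuous_on UNIV (\<lambda>t. s * t :: 'a::semitopological_semigroup)"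
  by (simp add: continuous_on_open_vimage open_vimage_left_translation)

lemma continuous_on_right_translation:
  "continuous_on UNIV (\<lambda>s. s * t :: 'a::semitopological_semigroup)"
  by (simp add: continuous_on_open_vimage open_vimage_right_translation)

(* The algebra C(S) is the library's set bcontfun of bounded continuous functions, at type
   'a \<Rightarrow> complex, where 'a is the semigroup S.  Its elements are kept as plain functions, with pointwise operations; the
   norm topology is that of the associated normed space type 'a \<Rightarrow>\<^sub>C complex. *)

definition norm_closure :: "('a::topological_space \<Rightarrow> complex) set \<Rightarrow> ('a \<Rightarrow> complex) set"
  where "norm_closure A = apply_bcontfun ` closure (apply_bcontfun -` A)"

definition norm_closed :: "('a::topological_space \<Rightarrow> complex) set \<Rightarrow> bool"
  where "norm_closed A \<longleftrightarrow> closed (apply_bcontfun -` A)"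

definition subalgebra :: "('a::topological_space \<Rightarrow> complex) set \<Rightarrow> bool"
  where "subalgebra A \<longleftrightarrow>
    A \<subseteq> bcontfun \<and>
    (\<lambda>s. 0) \<in> A \<and>
    (\<forall>f\<in>A. \<forall>g\<in>A. (\<lambda>s. f s + g s) \<in> A) \<and>
    (\<forall>c. \<forall>f\<in>A. (\<lambda>s. c * f s) \<in> A) \<and>
    (\<forall>f\<in>A. \<forall>g\<in>A. (\<lambda>s. f s * g s) \<in> A)"

definition unital_cstar_subalgebra :: "('a::topological_space \<Rightarrow> complex) set \<Rightarrow> bool"
  where "unital_cstar_subalgebra A \<longleftrightarrow>
    subalgebra A \<and>
    (\<lambda>s. 1) \<in> A \<and>
    (\<forall>f\<in>A. (\<lambda>s. cnj (f s)) \<in> A) \<and>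
    norm_closed A"

(* Functionals and operators on a set of functions are made extensional, so that equality of
   them means equality on their domain. *)

definition spectrum :: "('a::topological_space \<Rightarrow> complex) set \<Rightarrow> (('a \<Rightarrow> complex) \<Rightarrow> complex) set"
  where "spectrum A = {\<mu> \<in> extensional A.
    (\<forall>f\<in>A. \<forall>g\<in>A. \<mu> (\<lambda>s. f s + g s) = \<mu> f + \<mu> g) \<and>
    (\<forall>c. \<forall>f\<in>A. \<mu> (\<lambda>s. c * f s) = c * \<mu> f) \<and>
    (\<forall>f\<in>A. \<forall>g\<in>A. \<mu> (\<lambda>s. f s * g s) = \<mu> f * \<mu> g) \<and>
    (\<exists>f\<in>A. \<mu> f \<noteq> 0)}"

definition left_translate :: "'a::semigroup_mult \<Rightarrow> ('a \<Rightarrow> complex) \<Rightarrow> 'a \<Rightarrow> complex"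
  where "left_translate s f = f \<circ> (\<lambda>t. s * t)"

definition T_op ::
    "(('a::semigroup_mult \<Rightarrow> complex) \<Rightarrow> complex) \<Rightarrow> ('a \<Rightarrow> complex) \<Rightarrow> 'a \<Rightarrow> complex"
  where "T_op \<mu> f = (\<lambda>s. \<mu> (left_translate s f))"

definition left_translation_invariant :: "('a::semigroup_mult \<Rightarrow> complex) set \<Rightarrow> bool"
  where "left_translation_invariant A \<longleftrightarrow> (\<forall>s. \<forall>f\<in>A. left_translate s f \<in> A)"

definition m_admissible :: "('a::semitopological_semigroup \<Rightarrow> complex) set \<Rightarrow> bool"
  where "m_admissible A \<longleftrightarrow>
    unital_cstar_subalgebra A \<and>
    left_translation_invariant A \<and>
    (\<forall>f\<in>A. \<forall>\<mu>\<in>spectrum A. T_op \<mu> f \<in> A)"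

definition LMC :: "('a::semitopological_semigroup \<Rightarrow> complex) set"
  where "LMC = {f \<in> bcontfun. \<forall>\<mu>\<in>spectrum bcontfun. continuous_on UNIV (\<lambda>s. \<mu> (left_translate s f))}"

definition Sigma_LMC ::
    "(('a::semitopological_semigroup \<Rightarrow> complex) \<Rightarrow> ('a \<Rightarrow> complex)) set"
  where "Sigma_LMC = {restrict (T_op \<mu>) LMC |\<mu>. \<mu> \<in> spectrum LMC}"

definition distal_functions :: "('a::semitopological_semigroup \<Rightarrow> complex) set"
  where "distal_functions = {f \<in> LMC.
    \<forall>\<sigma>\<in>Sigma_LMC. \<forall>\<epsilon>\<in>Sigma_LMC. compose LMC \<epsilon> \<epsilon> = \<epsilon> \<longrightarrow> \<epsilon> (\<sigma> f) = \<sigma> f}"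

primrec F_set :: "nat \<Rightarrow> ('a::semitopological_semigroup \<Rightarrow> complex) set"
  where
    "F_set 0 = {f. \<exists>c. cmod c = 1 \<and> f = (\<lambda>s. c)}"
  | "F_set (Suc k) = {f \<in> LMC. (\<forall>s. cmod (f s) = 1) \<and>
       (\<forall>\<sigma>\<in>Sigma_LMC. \<exists>g\<in>F_set k. \<sigma> f = (\<lambda>s. g s * f s))}"

definition W_k :: "nat \<Rightarrow> ('a::semitopological_semigroup \<Rightarrow> complex) set"
  where "W_k k = norm_closure (subalgebra hull F_set k)"

definition W :: "('a::semitopological_semigroup \<Rightarrow> complex) set"
  where "W = norm_closure (subalgebra hull (\<Union>k\<in>{1..}. F_set k))"

end

(* A character of a unital C*-subalgebra A of C(S) is a limit of evaluations at points of S, so by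
   compactness it extends to C(S) and restricts to LMC(S); hence every operator T_mu of A is
   induced by some sigma in Sigma.  The set F_k is a group of unimodular functions that is stable
   under conjugation, Sigma and left translations (which commute with Sigma), and each idempotent of
   Sigma fixes it pointwise: if eps f = h f with h in F_(k-1), then eps h = h by induction, so
   h f = eps (eps f) = h^2 f and h = 1.  All elements of Sigma being contractive homomorphisms, these
   properties pass to the generated closed algebra. *)

theory Submission
  imports Defs
begin

section \<open>Closed algebras of bounded continuous functions\<close>

text \<open>The obstacle is that three kinds of characters are in play: membership in LMC(S) is
  tested by characters of C(S), Sigma is indexed by characters of LMC(S), and m-admissibility of the
  generated algebra speaks of its own characters. Extending to C(S) and restricting again reconciles
  them. The extension starts from the generated algebra, whose stability under conjugation is
  inherited from its generators. For these, being unimodular, the conjugate is the reciprocal, and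
  multiplicative functionals respect reciprocals. All estimates on characters rest on one fact: in a
  closed unital algebra 1 - h is invertible as soon as |h| is bounded by some q < 1, so no character
  takes the value 1 at h. This gives contractivity and, applied to a normalised sum of squared
  distances, the approximation by evaluations. Distality asks for \<epsilon>(\<sigma> f) = \<sigma>
  f. As the generated algebra is stable under Sigma, it is enough that idempotents fix each of its
  elements.\<close>

lemma bcontfun_mult:
  fixes f g :: "'a::topological_space \<Rightarrow> complex"
  assumes "f \<in> bcontfun" "g \<in> bcontfun"
  shows "(\<lambda>s. f s * g s) \<in> bcontfun"
proof -
  obtain a b where a: "\<And>s. cmod (f s) \<le> a" and b: "\<And>s. cmod (g s) \<le> b"
    using assms by (auto simp: bcontfun_def bounded_iff)
  have "cmod (f s * g s) \<le> a * b" for s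
    unfolding norm_mult by (intro mult_mono a b) (use a[of s] norm_ge_zero[of "f s"] in linarith, simp)
  with assms show ?thesis
    by (intro bcontfun_normI[where b = "a * b"]) (auto simp: bcontfun_def intro!: continuous_intros)
qed

lemma bcontfun_cnj: "(f :: 'a::topological_space \<Rightarrow> complex) \<in> bcontfun \<Longrightarrow> (\<lambda>s. cnj (f s)) \<in> bcontfun"
  by (auto simp: bcontfun_def bounded_iff intro!: continuous_intros)

lemma bcontfun_bounded:
  assumes "(f :: 'a::topological_space \<Rightarrow> complex) \<in> bcontfun"
  shows "\<exists>b. \<forall>s. cmod (f s) \<le> b"
  using assms by (auto simp: bcontfun_def bounded_iff)

text \<open>Turns closure in the wrapped normed type into uniform approximation of plain functions,
  the form in which the later estimates are made. The bound is non-strict because strict pointwise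
  bounds give only a non-strict bound on the supremum; the converse direction therefore works with e
  / 2.\<close>

lemma norm_closure_iff:
  assumes "A \<subseteq> bcontfun"
  shows "f \<in> norm_closure A \<longleftrightarrow> f \<in> bcontfun \<and> (\<forall>e>0. \<exists>g\<in>A. \<forall>s. cmod (f s - g s) \<le> e)"
proof safe
  assume "f \<in> norm_closure A"
  then obtain F where F: "f = apply_bcontfun F" "F \<in> closure (apply_bcontfun -` A)"
    by (auto simp: norm_closure_def)
  show "f \<in> bcontfun" by (simp add: F(1) apply_bcontfun)
  fix e :: real assume "e > 0"
  with F(2) obtain G where G: "apply_bcontfun G \<in> A" "dist G F < e"
    by (auto simp: closure_approachable)
  have "cmod (f s - G s) \<le> e" for s
    using dist_bounded[of F s G] G(2) unfolding F(1) dist_commute[of G F] dist_norm[of "_ :: complex"] by linarith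
  with G(1) show "\<exists>g\<in>A. \<forall>s. cmod (f s - g s) \<le> e" by blast
next
  assume f: "f \<in> bcontfun" and *: "\<forall>e>0. \<exists>g\<in>A. \<forall>s. cmod (f s - g s) \<le> e"
  obtain F where F: "f = apply_bcontfun F" using f by (rule bcontfunE)
  have "F \<in> closure (apply_bcontfun -` A)"
    unfolding closure_approachable
  proof (intro allI impI)
    fix e :: real assume "e > 0"
    then obtain g where g: "g \<in> A" "\<And>s. cmod (f s - g s) \<le> e / 2"
      using * by (meson half_gt_zero)
    obtain G where G: "g = apply_bcontfun G" using g(1) assms by (blast elim: bcontfunE)
    have "dist G F \<le> e / 2"
      by (rule dist_bound) (use g(2) in \<open>simp add: F G dist_norm norm_minus_commute\<close>)
    with g(1) G \<open>e > 0\<close> show "\<exists>G\<in>apply_bcontfun -` A. dist G F < e" by force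
  qed
  then show "f \<in> norm_closure A" by (auto simp: norm_closure_def F)
qed

lemma norm_closed_iff: "norm_closed A \<longleftrightarrow> norm_closure A \<subseteq> A"
proof
  assume "norm_closed A"
  then show "norm_closure A \<subseteq> A" by (auto simp: norm_closed_def norm_closure_def)
next
  assume "norm_closure A \<subseteq> A"
  then have "closure (apply_bcontfun -` A) \<subseteq> apply_bcontfun -` A" by (auto simp: norm_closure_def)
  then show "norm_closed A" unfolding norm_closed_def closure_subset_eq .
qed

lemma norm_closed_norm_closure: "norm_closed (norm_closure A)"
  unfolding norm_closed_def norm_closure_def
  by (simp add: inj_vimage_image_eq inj_def apply_bcontfun_inject)

lemma norm_closure_approx:
  assumes "f \<in> norm_closure A" "A \<subseteq> bcontfun" "e > 0"
  obtains g where "g \<in> A" "\<And>s. cmod (f s - g s) \<le> e"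
  using assms norm_closure_iff[of A f] by blast

lemma norm_closure_superset: "A \<subseteq> norm_closure A" if "A \<subseteq> bcontfun"
proof
  fix f assume "f \<in> A"
  then show "f \<in> norm_closure A"
    using that by (auto simp: norm_closure_iff intro!: bexI[of _ f])
qed

lemma norm_closure_minimal: "A \<subseteq> B \<Longrightarrow> norm_closed B \<Longrightarrow> norm_closure A \<subseteq> B"
proof -
  assume "A \<subseteq> B" "norm_closed B"
  then have "norm_closure A \<subseteq> norm_closure B"
    unfolding norm_closure_def by (intro image_mono closure_mono vimage_mono)
  with \<open>norm_closed B\<close> show ?thesis by (auto simp: norm_closed_iff)
qed

lemma norm_closedD:
  assumes "norm_closed A" "A \<subseteq> bcontfun" "f \<in> bcontfun"
    and "\<And>e. e > 0 \<Longrightarrow> \<exists>g\<in>A. \<forall>s. cmod (f s - g s) \<le> e"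
  shows "f \<in> A"
  using assms norm_closed_iff[of A] norm_closure_iff[of A f] by blast

section \<open>Generated subalgebras and their uniform closures\<close>

lemma subalgebra_add: "subalgebra A \<Longrightarrow> f \<in> A \<Longrightarrow> g \<in> A \<Longrightarrow> (\<lambda>s. f s + g s) \<in> A"
  and subalgebra_scale: "subalgebra A \<Longrightarrow> f \<in> A \<Longrightarrow> (\<lambda>s. c * f s) \<in> A"
  by (simp_all add: subalgebra_def)

lemma subalgebra_bcontfun: "subalgebra bcontfun"
  by (auto simp: subalgebra_def const_bcontfun intro: plus_cont bcontfun_mult)

lemma unital_cstar_bcontfun: "unital_cstar_subalgebra bcontfun"
proof -
  have "norm_closed bcontfun" by (auto simp: norm_closed_iff norm_closure_def apply_bcontfun)
  then show ?thesis
    using subalgebra_bcontfun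
    by (simp add: unital_cstar_subalgebra_def const_bcontfun bcontfun_cnj)
qed

lemma subalgebra_hull_subset: "G \<subseteq> bcontfun \<Longrightarrow> subalgebra hull G \<subseteq> bcontfun"
  by (rule hull_minimal[where S = subalgebra, OF _ subalgebra_bcontfun])

text \<open>The hypothesis ensures that some subalgebra contains \<open>G\<close>; otherwise the
  hull would be an intersection over the empty family, that is, the whole function type.\<close>

lemma subalgebra_hull:
  assumes "G \<subseteq> bcontfun"
  shows "subalgebra (subalgebra hull G)"
  using subalgebra_hull_subset[OF assms]
  unfolding subalgebra_def by (auto simp: hull_def)

lemma subalgebra_norm_closure:
  assumes "subalgebra A"
  shows "subalgebra (norm_closure A)"
proof -
  have A: "A \<subseteq> bcontfun" using assms by (auto simp: subalgebra_def)
  note iff = norm_closure_iff[OF A]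
  have add: "(\<lambda>s. f s + g s) \<in> norm_closure A" if fg: "f \<in> norm_closure A" "g \<in> norm_closure A" for f g
    unfolding iff
  proof (intro conjI allI impI)
    show "(\<lambda>s. f s + g s) \<in> bcontfun" using that by (auto simp: iff intro: plus_cont)
    fix e :: real assume "e > 0"
    then have e2: "e / 2 > 0" by simp
    obtain u where u: "u \<in> A" "\<And>s. cmod (f s - u s) \<le> e / 2"
      using norm_closure_approx[OF fg(1) A e2] by blast
    obtain v where v: "v \<in> A" "\<And>s. cmod (g s - v s) \<le> e / 2"
      using norm_closure_approx[OF fg(2) A e2] by blast
    have "cmod (f s + g s - (u s + v s)) \<le> e" for s
      using norm_triangle_ineq[of "f s - u s" "g s - v s"] u(2)[of s] v(2)[of s]
      by (simp add: algebra_simps)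
    moreover have "(\<lambda>s. u s + v s) \<in> A" using assms u v by (auto simp: subalgebra_def)
    ultimately show "\<exists>h\<in>A. \<forall>s. cmod (f s + g s - h s) \<le> e" by (intro bexI) auto
  qed
  have mult: "(\<lambda>s. f s * g s) \<in> norm_closure A" if fg: "f \<in> norm_closure A" "g \<in> norm_closure A" for f g
    unfolding iff
  proof (intro conjI allI impI)
    show "(\<lambda>s. f s * g s) \<in> bcontfun" using that by (auto simp: iff intro: bcontfun_mult)
    fix e :: real assume e: "e > 0"
    obtain a where a: "\<And>s. cmod (f s) \<le> a" using fg(1) bcontfun_bounded unfolding iff by blast
    have a0: "a \<ge> 0" using a norm_ge_zero order_trans by blast
    \<comment> \<open>The choices are nested to fit f g - u v = f (g - v) + (f - u) v: the tolerance
      for \<open>v\<close> depends on the bound \<open>a\<close> of \<open>f\<close>, and the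
      tolerance for \<open>u\<close> on the bound \<open>b\<close> of the chosen \<open>v\<close>.
      Adding 1 keeps the denominators positive.\<close>
    obtain v where v: "v \<in> A" "\<And>s. cmod (g s - v s) \<le> e / 2 / (a + 1)"
    proof -
      have "e / 2 / (a + 1) > 0" using e a0 by simp
      then show ?thesis using that norm_closure_approx[OF fg(2) A] by blast
    qed
    obtain b where b: "\<And>s. cmod (v s) \<le> b" using v(1) A bcontfun_bounded by blast
    have b0: "b \<ge> 0" using b norm_ge_zero order_trans by blast
    obtain u where u: "u \<in> A" "\<And>s. cmod (f s - u s) \<le> e / 2 / (b + 1)"
    proof -
      have "e / 2 / (b + 1) > 0" using e b0 by simp
      then show ?thesis using that norm_closure_approx[OF fg(1) A] by blast
    qed
    have "cmod (f s * g s - u s * v s) \<le> e" for s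
    proof -
      have "f s * g s - u s * v s = f s * (g s - v s) + (f s - u s) * v s" by (simp add: algebra_simps)
      then have "cmod (f s * g s - u s * v s) \<le> cmod (f s) * cmod (g s - v s) + cmod (f s - u s) * cmod (v s)"
        by (metis norm_mult norm_triangle_ineq)
      also have "\<dots> \<le> (a + 1) * (e / 2 / (a + 1)) + (e / 2 / (b + 1)) * (b + 1)"
      proof (intro add_mono mult_mono)
        show "cmod (f s) \<le> a + 1" "cmod (v s) \<le> b + 1" using a[of s] b[of s] by auto
      qed (use v(2) u(2) a0 b0 e in auto)
      also have "\<dots> = e"
      proof -
        have cancel: "x * (y / x) = y" if "x > 0" for x y :: real using that by simp
        have "(a + 1) * (e / 2 / (a + 1)) = e / 2" "(b + 1) * (e / 2 / (b + 1)) = e / 2"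
          by (rule cancel, use a0 b0 in simp)+
        then show ?thesis by (simp only: mult.commute[of _ "b + 1"])
      qed
      finally show ?thesis .
    qed
    moreover have "(\<lambda>s. u s * v s) \<in> A" using assms u v by (auto simp: subalgebra_def)
    ultimately show "\<exists>h\<in>A. \<forall>s. cmod (f s * g s - h s) \<le> e" by (intro bexI) auto
  qed
  have scale: "(\<lambda>s. c * f s) \<in> norm_closure A" if f: "f \<in> norm_closure A" for f c
    unfolding iff
  proof (intro conjI allI impI)
    show "(\<lambda>s. c * f s) \<in> bcontfun"
      using that const_bcontfun[of c] by (auto simp: iff intro: bcontfun_mult)
    fix e :: real assume e: "e > 0"
    then have "e / (cmod c + 1) > 0" by (simp add: add_nonneg_pos)
    then obtain u where u: "u \<in> A" "\<And>s. cmod (f s - u s) \<le> e / (cmod c + 1)"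
      using norm_closure_approx[OF f A] by blast
    have "cmod (c * f s - c * u s) \<le> e" for s
    proof -
      have "cmod (c * f s - c * u s) = cmod c * cmod (f s - u s)"
        by (simp add: right_diff_distrib[symmetric] norm_mult)
      also have "\<dots> \<le> (cmod c + 1) * (e / (cmod c + 1))"
        by (intro mult_mono u) auto
      also have "\<dots> = e" using norm_ge_zero[of c] by (simp add: add_nonneg_eq_0_iff)
      finally show ?thesis .
    qed
    moreover have "(\<lambda>s. c * u s) \<in> A" using assms u by (auto simp: subalgebra_def)
    ultimately show "\<exists>h\<in>A. \<forall>s. cmod (c * f s - h s) \<le> e" by (intro bexI) auto
  qed
  show ?thesis
    using add mult scale norm_closure_superset[OF A] assms iff by (auto simp: subalgebra_def)
qed

section \<open>Constants, powers and inverses inside a closed unital algebra\<close>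

lemma subalgebra_diff:
  assumes "subalgebra A" "f \<in> A" "g \<in> A"
  shows "(\<lambda>s. f s - g s) \<in> A"
proof -
  have "(\<lambda>s. f s + (-1) * g s) \<in> A"
    by (rule subalgebra_add[OF assms(1,2) subalgebra_scale[OF assms(1,3)]])
  then show ?thesis by simp
qed

lemma subalgebra_const:
  assumes "subalgebra A" "(\<lambda>s. 1) \<in> A"
  shows "(\<lambda>s. c) \<in> A"
proof -
  have "(\<lambda>s. c * 1) \<in> A"
    by (rule subalgebra_scale[OF assms])
  then show ?thesis by simp
qed

lemma subalgebra_power:
  assumes "subalgebra A" "(\<lambda>s. 1) \<in> A" "f \<in> A"
  shows "(\<lambda>s. f s ^ n) \<in> A"
  using assms by (induction n) (auto simp: subalgebra_def)

lemma subalgebra_sum: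
  assumes "subalgebra A" "finite I" "\<And>i. i \<in> I \<Longrightarrow> f i \<in> A"
  shows "(\<lambda>s. \<Sum>i\<in>I. f i s) \<in> A"
  using assms(2,3) by induction (use assms(1) in \<open>auto simp: subalgebra_def\<close>)

text \<open>Neumann series: the partial sums of the powers of \<open>h\<close> lie in
  \<open>A\<close> and differ from the inverse by h^n / (1 - h), uniformly at most q^n / (1 -
  q).\<close>

lemma inverse_one_minus_mem:
  assumes A: "subalgebra A" "(\<lambda>s. 1) \<in> A" "norm_closed A"
    and h: "h \<in> A" "\<And>s. cmod (h s) \<le> q" and q: "q < 1"
  shows "(\<lambda>s. inverse (1 - h s)) \<in> A"
proof (rule norm_closedD[OF A(3)])
  show sub: "A \<subseteq> bcontfun" using A by (simp add: subalgebra_def)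
  have q0: "0 \<le> q" using h(2) norm_ge_zero order_trans by blast
  have ge: "1 - q \<le> cmod (1 - h s)" for s
    using norm_triangle_ineq2[of 1 "h s"] h(2)[of s] by simp
  then have nz: "1 - h s \<noteq> 0" for s
    using q by (metis diff_gt_0_iff_gt norm_zero not_le)
  have le: "cmod (inverse (1 - h s)) \<le> 1 / (1 - q)" for s
    unfolding norm_inverse inverse_eq_divide[symmetric] using q by (intro le_imp_inverse_le ge) auto
  show "(\<lambda>s. inverse (1 - h s)) \<in> bcontfun"
  proof (rule bcontfun_normI)
    show "continuous_on UNIV (\<lambda>s. inverse (1 - h s))"
      using h(1) sub nz by (intro continuous_intros) (auto simp: bcontfun_def)
  qed (rule le)
  fix e :: real assume "e > 0"
  have "(\<lambda>n. q ^ n * (1 / (1 - q))) \<longlonglongrightarrow> 0 * (1 / (1 - q))"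
    by (intro tendsto_mult LIMSEQ_power_zero tendsto_const) (use q q0 in auto)
  then have "\<forall>\<^sub>F n in sequentially. q ^ n * (1 / (1 - q)) < e"
    using \<open>e > 0\<close> by (auto dest: order_tendstoD(2)[where a = e])
  then obtain n where n: "q ^ n * (1 / (1 - q)) < e"
    by (auto simp: eventually_sequentially)
  have "(\<lambda>s. \<Sum>i<n. h s ^ i) \<in> A"
    by (intro subalgebra_sum subalgebra_power A h) auto
  moreover have "cmod (inverse (1 - h s) - (\<Sum>i<n. h s ^ i)) \<le> e" for s
  proof -
    have "(1 - h s) * (\<Sum>i<n. h s ^ i) = 1 - h s ^ n" by (simp add: one_diff_power_eq)
    then have "inverse (1 - h s) - (\<Sum>i<n. h s ^ i) = h s ^ n * inverse (1 - h s)"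
      using nz[of s] by (simp add: field_simps)
    also have "cmod \<dots> \<le> q ^ n * (1 / (1 - q))"
      unfolding norm_mult norm_power using h(2) q0 by (intro mult_mono power_mono le) auto
    finally show ?thesis using n by simp
  qed
  ultimately show "\<exists>g\<in>A. \<forall>s. cmod (inverse (1 - h s) - g s) \<le> e"
    by (intro bexI[of _ "\<lambda>s. \<Sum>i<n. h s ^ i"]) auto
qed

section \<open>Characters\<close>

lemma spectrum_add: "\<mu> \<in> spectrum A \<Longrightarrow> f \<in> A \<Longrightarrow> g \<in> A \<Longrightarrow> \<mu> (\<lambda>s. f s + g s) = \<mu> f + \<mu> g"
  and spectrum_scale: "\<mu> \<in> spectrum A \<Longrightarrow> f \<in> A \<Longrightarrow> \<mu> (\<lambda>s. c * f s) = c * \<mu> f"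
  and spectrum_mult: "\<mu> \<in> spectrum A \<Longrightarrow> f \<in> A \<Longrightarrow> g \<in> A \<Longrightarrow> \<mu> (\<lambda>s. f s * g s) = \<mu> f * \<mu> g"
  by (auto simp: spectrum_def)

lemma spectrum_one:
  assumes "\<mu> \<in> spectrum A" "(\<lambda>s. 1) \<in> A"
  shows "\<mu> (\<lambda>s. 1) = 1"
proof -
  obtain f where "f \<in> A" "\<mu> f \<noteq> 0" using assms(1) by (auto simp: spectrum_def)
  then show ?thesis using spectrum_mult[OF assms(1) _ assms(2), of f] by simp
qed

lemma spectrum_const:
  assumes "\<mu> \<in> spectrum A" "(\<lambda>s. 1) \<in> A"
  shows "\<mu> (\<lambda>s. c) = c"
  using spectrum_scale[OF assms, of c] spectrum_one[OF assms] by simp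

lemma spectrum_diff:
  assumes "subalgebra A" "\<mu> \<in> spectrum A" "f \<in> A" "g \<in> A"
  shows "\<mu> (\<lambda>s. f s - g s) = \<mu> f - \<mu> g"
proof -
  have "(\<lambda>s. (-1) * g s) \<in> A" by (rule subalgebra_scale[OF assms(1,4)])
  then have "\<mu> (\<lambda>s. f s + (-1) * g s) = \<mu> f + \<mu> (\<lambda>s. (-1) * g s)"
    using assms by (intro spectrum_add) auto
  also have "\<mu> (\<lambda>s. (-1) * g s) = - \<mu> g" using spectrum_scale[OF assms(2,4), of "-1"] by simp
  finally show ?thesis by simp
qed

lemma spectrum_inverse:
  assumes "\<mu> \<in> spectrum A" "(\<lambda>s. 1) \<in> A" "f \<in> A" "g \<in> A" "\<And>s. f s * g s = 1"
  shows "\<mu> f * \<mu> g = 1"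
  using spectrum_mult[OF assms(1,3,4)] spectrum_one[OF assms(1,2)] assms(5) by simp

text \<open>Automatic contractivity of characters. If |\<mu> f| exceeded \<open>r\<close>, then h =
  f / \<mu> f would be bounded by some q < 1, so 1 - h would be invertible in \<open>A\<close>
  although \<mu> sends it to 0.\<close>

lemma spectrum_norm_le:
  assumes A: "subalgebra A" "(\<lambda>s. 1) \<in> A" "norm_closed A" and \<mu>: "\<mu> \<in> spectrum A"
    and f: "f \<in> A" "\<And>s. cmod (f s) \<le> r"
  shows "cmod (\<mu> f) \<le> r"
proof (rule ccontr)
  assume "\<not> cmod (\<mu> f) \<le> r"
  then have r: "r < cmod (\<mu> f)" by simp
  have r0: "0 \<le> r" using f(2) norm_ge_zero order_trans by blast
  have nz: "\<mu> f \<noteq> 0" using r r0 by auto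
  define h where "h = (\<lambda>s. inverse (\<mu> f) * f s)"
  have hA: "h \<in> A" using A f by (auto simp: subalgebra_def h_def)
  have h1: "cmod (h s) \<le> r / cmod (\<mu> f)" for s
    unfolding h_def norm_mult norm_inverse using f(2)[of s] nz by (simp add: field_simps)
  have q: "r / cmod (\<mu> f) < 1" using r nz by simp
  have "\<mu> (\<lambda>s. 1 - h s) * \<mu> (\<lambda>s. inverse (1 - h s)) = 1"
  proof (rule spectrum_inverse[OF \<mu> A(2)])
    show "(\<lambda>s. 1 - h s) \<in> A" by (rule subalgebra_diff[OF A(1,2) hA])
    show "(\<lambda>s. inverse (1 - h s)) \<in> A" by (rule inverse_one_minus_mem[OF A hA h1 q])
    have "h s \<noteq> 1" for s using h1[of s] q by auto
    then show "(1 - h s) * inverse (1 - h s) = 1" for s by (metis eq_iff_diff_eq_0 right_inverse)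
  qed
  moreover have "\<mu> (\<lambda>s. 1 - h s) = 0"
    using spectrum_diff[OF A(1) \<mu> A(2) hA] spectrum_one[OF \<mu> A(2)] spectrum_scale[OF \<mu> f(1), of "inverse (\<mu> f)"] nz
    by (simp add: h_def)
  ultimately show False by simp
qed

text \<open>If the values at points avoided a neighbourhood of the character, then the sum of the
  squared distances \<open>\<bar>f s - \<mu> f\<bar>\<^sup>2\<close> would be invertible and yet lie in the kernel of the character.\<close>

lemma spectrum_approx_evaluation:
  assumes A: "unital_cstar_subalgebra A" and \<mu>: "\<mu> \<in> spectrum A"
    and X: "finite X" "X \<subseteq> A" and e: "e > 0"
  shows "\<exists>s. \<forall>f\<in>X. cmod (f s - \<mu> f) \<le> e"
proof (rule ccontr)
  assume *: "\<not> ?thesis"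
  have sA: "subalgebra A" and one: "(\<lambda>s. 1) \<in> A" and nc: "norm_closed A"
    and cnjA: "\<And>f. f \<in> A \<Longrightarrow> (\<lambda>s. cnj (f s)) \<in> A"
    using A by (auto simp: unital_cstar_subalgebra_def)
  have multA: "\<And>f g. f \<in> A \<Longrightarrow> g \<in> A \<Longrightarrow> (\<lambda>s. f s * g s) \<in> A"
    and scaleA: "\<And>c f. f \<in> A \<Longrightarrow> (\<lambda>s. c * f s) \<in> A"
    and sub: "A \<subseteq> bcontfun" using sA by (auto simp: subalgebra_def)
  define d where "d = (\<lambda>f s. f s - \<mu> f)"
  have dA: "d f \<in> A" "\<mu> (d f) = 0" if "f \<in> A" for f
    using subalgebra_diff[OF sA that subalgebra_const[OF sA one]]
      spectrum_diff[OF sA \<mu> that subalgebra_const[OF sA one]] spectrum_const[OF \<mu> one]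
    by (auto simp: d_def)
  \<comment> \<open>The conjugate factors turn each summand into |d f|^2, and they stay in
    \<open>A\<close> because \<open>A\<close> is closed under conjugation.\<close>
  define g where "g = (\<lambda>s. \<Sum>f\<in>X. d f s * cnj (d f s))"
  have g_eq: "g s = of_real (\<Sum>f\<in>X. (cmod (d f s))\<^sup>2)" for s
    by (simp add: g_def complex_norm_square[symmetric])
  have gA: "g \<in> A"
    unfolding g_def using X dA cnjA multA by (intro subalgebra_sum[OF sA]) auto
  have "g \<in> A \<and> \<mu> g = 0"
    unfolding g_def using X
  proof induction
    case empty
    show ?case using sA spectrum_scale[OF \<mu> one, of 0] by (simp add: subalgebra_def)
  next
    case (insert f X)
    have 1: "(\<lambda>s. d f s * cnj (d f s)) \<in> A" using insert dA multA cnjA by auto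
    have 2: "\<mu> (\<lambda>s. d f s * cnj (d f s)) = 0"
      using spectrum_mult[OF \<mu> dA(1) cnjA[OF dA(1)], of f f] dA(2)[of f] insert by auto
    show ?case using insert spectrum_add[OF \<mu> 1] 1 2 sA by (auto simp: subalgebra_def)
  qed
  then have g0: "\<mu> g = 0" by simp
  obtain b where b: "\<And>s. cmod (g s) \<le> b" using gA sub bcontfun_bounded by blast
  have ge: "e\<^sup>2 \<le> (\<Sum>f\<in>X. (cmod (d f s))\<^sup>2)" for s
  proof -
    obtain f where f: "f \<in> X" "e < cmod (d f s)" using * unfolding d_def by (meson not_le)
    have "e\<^sup>2 \<le> (cmod (d f s))\<^sup>2" using f e by (intro power_mono) auto
    also have "\<dots> \<le> (\<Sum>f\<in>X. (cmod (d f s))\<^sup>2)" using X f by (intro member_le_sum) auto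
    finally show ?thesis .
  qed
  have le: "(\<Sum>f\<in>X. (cmod (d f s))\<^sup>2) \<le> b" for s
    using b[of s] unfolding g_eq norm_of_real by simp
  \<comment> \<open>Types are nonempty, so the lower bound e^2 and the upper bound \<open>b\<close>
    can be compared at some point.\<close>
  have b0: "b > 0" using ge[of undefined] le[of undefined] e by (smt (verit) zero_less_power)
  \<comment> \<open>Dividing by the upper bound \<open>b\<close> brings \<open>g\<close> into the
    range of the Neumann series: e^2 \<le> g \<le> b gives 0 \<le> h \<le> 1 - e^2 / b < 1, and 1 -
    h = g / b.\<close>
  define h where "h = (\<lambda>s. 1 - of_real (1 / b) * g s)"
  have hA: "h \<in> A" unfolding h_def by (intro subalgebra_diff[OF sA] one scaleA gA)
  have hq: "cmod (h s) \<le> 1 - e\<^sup>2 / b" for s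
  proof -
    have "h s = of_real (1 - (\<Sum>f\<in>X. (cmod (d f s))\<^sup>2) / b)" by (simp add: h_def g_eq)
    then have "cmod (h s) = \<bar>1 - (\<Sum>f\<in>X. (cmod (d f s))\<^sup>2) / b\<bar>" by (metis norm_of_real)
    also have "\<dots> = 1 - (\<Sum>f\<in>X. (cmod (d f s))\<^sup>2) / b" using le[of s] b0 by simp
    also have "\<dots> \<le> 1 - e\<^sup>2 / b" using ge[of s] b0 by (simp add: divide_right_mono)
    finally show ?thesis .
  qed
  have q: "1 - e\<^sup>2 / b < 1" using e b0 by simp
  have "\<mu> (\<lambda>s. 1 - h s) * \<mu> (\<lambda>s. inverse (1 - h s)) = 1"
  proof (rule spectrum_inverse[OF \<mu> one])
    show "(\<lambda>s. 1 - h s) \<in> A" by (rule subalgebra_diff[OF sA one hA])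
    show "(\<lambda>s. inverse (1 - h s)) \<in> A" by (rule inverse_one_minus_mem[OF sA one nc hA hq q])
    have "h s \<noteq> 1" for s using hq[of s] q by auto
    then show "(1 - h s) * inverse (1 - h s) = 1" for s by (metis eq_iff_diff_eq_0 right_inverse)
  qed
  moreover have "\<mu> (\<lambda>s. 1 - h s) = 0"
    using spectrum_scale[OF \<mu> gA, of "of_real (1 / b)"] g0 by (simp add: h_def)
  ultimately show False by simp
qed

text \<open>The extension is a cluster point of evaluations in a product of discs. Linearity and
  multiplicativity are closed conditions that hold at every evaluation, hence at the cluster point.
  Agreement with \<mu> on \<open>A\<close> is imposed by the closed sets \<open>D (f, e)\<close>,
  which have the finite intersection property because evaluations approximate \<mu> on finite
  subsets of \<open>A\<close>.\<close>

lemma spectrum_extend: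
  assumes A: "unital_cstar_subalgebra A" and \<mu>: "\<mu> \<in> spectrum A"
  shows "\<exists>\<nu>\<in>spectrum bcontfun. \<forall>f\<in>A. \<nu> f = \<mu> f"
proof -
  have sub: "A \<subseteq> bcontfun" and one: "(\<lambda>s. 1) \<in> A"
    using A by (auto simp: unital_cstar_subalgebra_def subalgebra_def)
  define ev :: "'a \<Rightarrow> ('a \<Rightarrow> complex) \<Rightarrow> complex" where "ev s = (\<lambda>f\<in>bcontfun. f s)" for s
  obtain B :: "('a \<Rightarrow> complex) \<Rightarrow> real" where B: "\<And>f s. f \<in> bcontfun \<Longrightarrow> cmod (f s) \<le> B f"
    using bcontfun_bounded by metis
  \<comment> \<open>Compact by Tychonoff. Coordinates outside C(S) are pinned to
    \<open>undefined\<close>, so every point of \<open>K\<close> is extensional, as membership in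
    \<open>spectrum\<close> demands.\<close>
  define K where "K = (\<Pi>\<^sub>E f\<in>(UNIV :: ('a \<Rightarrow> complex) set).
    if f \<in> bcontfun then cball (0::complex) (B f) else {undefined})"
  have "compactin (product_topology (\<lambda>_. euclidean) UNIV) K"
    unfolding K_def compactin_PiE by auto
  then have K: "compact K" by (simp add: euclidean_product_topology)
  have evK: "range ev \<subseteq> K" by (auto simp: K_def ev_def B)
  define D where "D p = {\<phi>. cmod (\<phi> (fst p) - \<mu> (fst p)) \<le> snd p}"
    for p :: "('a \<Rightarrow> complex) \<times> real"
  \<comment> \<open>The closure of the evaluations is one of the sets, so that the limit inherits
    their algebraic identities and does not merely take the right values on
    \<open>A\<close>.\<close>
  define \<F> where "\<F> = insert (closure (range ev)) (D ` (A \<times> {0<..}))"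
  have "K \<inter> \<Inter>\<F> \<noteq> {}"
  proof (rule compact_imp_fip[OF K])
    fix T assume "T \<in> \<F>"
    moreover have "closed (D p)" for p
      unfolding D_def
      by (rule closed_Collect_le) (rule continuous_on_product_coordinates continuous_on_norm continuous_on_diff continuous_on_const)+
    ultimately show "closed T" by (auto simp: \<F>_def)
  next
    fix \<F>' assume fin: "finite \<F>'" and "\<F>' \<subseteq> \<F>"
    then have "\<F>' - {closure (range ev)} \<subseteq> D ` (A \<times> {0<..})" by (auto simp: \<F>_def)
    then obtain P where P: "P \<subseteq> A \<times> {0<..}" "finite P" "\<F>' - {closure (range ev)} = D ` P"
      using fin by (meson finite_Diff finite_subset_image)
    \<comment> \<open>Inserting 1 keeps the minimum meaningful and positive when \<open>P\<close> is
      empty.\<close>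
    define e where "e = Min (insert 1 (snd ` P))"
    have "\<And>x. x \<in> insert 1 (snd ` P) \<Longrightarrow> x > 0" using P(1) by auto
    then have e: "e > 0" "\<And>p. p \<in> P \<Longrightarrow> e \<le> snd p" using P(2) by (auto simp: e_def)
    obtain s where s: "\<And>f. f \<in> fst ` P \<Longrightarrow> cmod (f s - \<mu> f) \<le> e"
      using spectrum_approx_evaluation[OF A \<mu>, of "fst ` P" e] P(1,2) e(1) by fastforce
    have "ev s \<in> D p" if "p \<in> P" for p
    proof -
      have "fst p \<in> bcontfun" using that P(1) sub mem_Times_iff by (metis subset_iff)
      then show ?thesis using s[of "fst p"] e(2)[OF that] that by (auto simp: D_def ev_def)
    qed
    then have evD: "D ` P \<subseteq> {T. ev s \<in> T}" by (intro image_subsetI) simp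
    have "\<F>' - {closure (range ev)} \<subseteq> {T. ev s \<in> T}" unfolding P(3) by (rule evD)
    moreover have "ev s \<in> closure (range ev)" by (rule subsetD[OF closure_subset]) (rule rangeI)
    ultimately have "\<F>' \<subseteq> {T. ev s \<in> T}"
      by (simp only: Diff_subset_conv)
        (metis insert_subset mem_Collect_eq Un_insert_left Un_empty_left insert_absorb)
    then have "\<And>T. T \<in> \<F>' \<Longrightarrow> ev s \<in> T" by (rule CollectD[OF subsetD])
    then have "ev s \<in> K \<inter> \<Inter>\<F>'" using subsetD[OF evK rangeI] by (intro IntI InterI)
    then show "K \<inter> \<Inter>\<F>' \<noteq> {}" by (metis emptyE)
  qed
  then obtain \<nu> where \<nu>: "\<nu> \<in> K \<inter> \<Inter>\<F>" by (metis ex_in_conv)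
  have \<nu>K: "\<nu> \<in> K" using \<nu> by (rule IntD1)
  have \<nu>c: "\<nu> \<in> closure (range ev)"
    using \<nu> unfolding \<F>_def by (meson IntD2 InterD insertI1)
  have \<nu>D: "\<nu> \<in> D p" if "p \<in> A \<times> {0<..}" for p
    using \<nu> that unfolding \<F>_def by (meson IntD2 InterD insertI2 imageI)
  have eq: "\<nu> f = \<mu> f" if "f \<in> A" for f
  proof -
    have "cmod (\<nu> f - \<mu> f) \<le> 0 + e" if "e > 0" for e
      using \<nu>D[of "(f, e)"] that \<open>f \<in> A\<close> by (simp add: D_def)
    then show ?thesis using field_le_epsilon[of "cmod (\<nu> f - \<mu> f)" 0] by auto
  qed
  \<comment> \<open>Every closed condition satisfied by all evaluations passes to \<nu>; the three
    algebraic laws below are instances.\<close>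
  have closed_range: "closed C \<Longrightarrow> range ev \<subseteq> C \<Longrightarrow> \<nu> \<in> C" for C
    by (rule subsetD[OF closure_minimal \<nu>c])
  have "\<nu> \<in> spectrum bcontfun"
    unfolding spectrum_def
  proof (intro CollectI conjI ballI allI)
    show "\<nu> \<in> extensional bcontfun"
      using \<nu>K by (auto simp: K_def extensional_def PiE_iff split: if_splits)
    fix f g :: "'a \<Rightarrow> complex" assume f: "f \<in> bcontfun" and g: "g \<in> bcontfun"
    have "\<nu> \<in> {\<phi>. \<phi> (\<lambda>s. f s + g s) = \<phi> f + \<phi> g}"
      by (rule closed_range, rule closed_Collect_eq)
        (rule continuous_on_product_coordinates continuous_on_add continuous_on_mult
          continuous_on_const | auto simp: ev_def f g plus_cont)+
    then show "\<nu> (\<lambda>s. f s + g s) = \<nu> f + \<nu> g" by simp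
    have "\<nu> \<in> {\<phi>. \<phi> (\<lambda>s. f s * g s) = \<phi> f * \<phi> g}"
      by (rule closed_range, rule closed_Collect_eq)
        (rule continuous_on_product_coordinates continuous_on_add continuous_on_mult
          continuous_on_const | auto simp: ev_def f g bcontfun_mult)+
    then show "\<nu> (\<lambda>s. f s * g s) = \<nu> f * \<nu> g" by simp
  next
    fix c and f :: "'a \<Rightarrow> complex" assume f: "f \<in> bcontfun"
    have "\<nu> \<in> {\<phi>. \<phi> (\<lambda>s. c * f s) = c * \<phi> f}"
      by (rule closed_range, rule closed_Collect_eq)
        (rule continuous_on_product_coordinates continuous_on_add continuous_on_mult
          continuous_on_const | auto simp: ev_def f bcontfun_mult const_bcontfun)+
    then show "\<nu> (\<lambda>s. c * f s) = c * \<nu> f" by simp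
  next
    show "\<exists>f\<in>bcontfun. \<nu> f \<noteq> 0"
      using eq[OF one] spectrum_one[OF \<mu> one] sub one by (intro bexI[of _ "\<lambda>s. 1"]) auto
  qed
  with eq show ?thesis by blast
qed

text \<open>The restriction cannot vanish identically because \<open>B\<close> contains 1, where
  \<mu> takes the value 1.\<close>

lemma spectrum_restrict:
  assumes B: "subalgebra B" "(\<lambda>s. 1) \<in> B" "B \<subseteq> A" and \<mu>: "\<mu> \<in> spectrum A"
  shows "restrict \<mu> B \<in> spectrum B"
proof -
  have "\<exists>f\<in>B. restrict \<mu> B f \<noteq> 0"
    using spectrum_one[OF \<mu>] B(2,3) by (intro bexI[of _ "\<lambda>s. 1"]) auto
  moreover have "f \<in> A" if "f \<in> B" for f using that B(3) by blast
  ultimately show ?thesis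
    using B(1) \<mu> unfolding spectrum_def subalgebra_def by simp
qed

section \<open>Left translations and the operators \<open>T_op \<mu>\<close>\<close>

lemma left_translate_apply [simp]: "left_translate s f t = f (s * t)"
  by (simp add: left_translate_def)

lemma left_translate_left_translate: "left_translate s (left_translate t f) = left_translate (t * s) f"
  by (simp add: fun_eq_iff mult.assoc)

lemma left_translate_bcontfun:
  fixes f :: "'a::semitopological_semigroup \<Rightarrow> complex"
  assumes "f \<in> bcontfun"
  shows "left_translate s f \<in> bcontfun"
proof -
  obtain b where "\<And>t. cmod (f t) \<le> b" using bcontfun_bounded[OF assms] by blast
  moreover have "continuous_on UNIV (\<lambda>t. f (s * t))"
    by (rule continuous_on_compose2[OF _ continuous_on_left_translation])
      (use assms in \<open>auto simp: bcontfun_def\<close>)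
  ultimately show ?thesis
    by (intro bcontfun_normI[where b = b]) (simp_all add: left_translate_def o_def)
qed

text \<open>By associativity L_s L_t = L_{ts}, so both sides at s equal \<mu>(L_{ts} f). This
  commutation carries translation invariance to LMC(S) and through the induction on
  \<open>F_set k\<close>.\<close>

lemma T_op_left_translate: "T_op \<mu> (left_translate t f) = left_translate t (T_op \<mu> f)"
  by (simp add: fun_eq_iff T_op_def left_translate_left_translate)

lemma
  assumes \<mu>: "\<mu> \<in> spectrum A" and A: "left_translation_invariant A" and f: "f \<in> A"
  shows T_op_add: "g \<in> A \<Longrightarrow> T_op \<mu> (\<lambda>s. f s + g s) = (\<lambda>s. T_op \<mu> f s + T_op \<mu> g s)"
    and T_op_scale: "T_op \<mu> (\<lambda>s. c * f s) = (\<lambda>s. c * T_op \<mu> f s)"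
    and T_op_mult: "g \<in> A \<Longrightarrow> T_op \<mu> (\<lambda>s. f s * g s) = (\<lambda>s. T_op \<mu> f s * T_op \<mu> g s)"
  using spectrum_add[OF \<mu>] spectrum_scale[OF \<mu>] spectrum_mult[OF \<mu>] A f
  by (auto simp: T_op_def left_translate_def o_def left_translation_invariant_def fun_eq_iff)

lemma T_op_diff:
  assumes "subalgebra A" "\<mu> \<in> spectrum A" "left_translation_invariant A" "f \<in> A" "g \<in> A"
  shows "T_op \<mu> (\<lambda>s. f s - g s) = (\<lambda>s. T_op \<mu> f s - T_op \<mu> g s)"
  using spectrum_diff[OF assms(1,2)] assms(3-)
  by (auto simp: T_op_def left_translate_def o_def left_translation_invariant_def fun_eq_iff)

lemma T_op_const:
  assumes "\<mu> \<in> spectrum A" "(\<lambda>s. 1) \<in> A"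
  shows "T_op \<mu> (\<lambda>s. c) = (\<lambda>s. c)"
  using spectrum_const[OF assms] by (simp add: T_op_def left_translate_def o_def)

lemma T_op_norm_le:
  assumes "subalgebra A" "(\<lambda>s. 1) \<in> A" "norm_closed A" "\<mu> \<in> spectrum A"
    and "left_translation_invariant A" "f \<in> A" "\<And>s. cmod (f s) \<le> r"
  shows "cmod (T_op \<mu> f s) \<le> r"
  unfolding T_op_def using assms
  by (intro spectrum_norm_le[OF assms(1-4)]) (auto simp: left_translation_invariant_def)

section \<open>LMC(S) as a closed, translation invariant algebra\<close>

lemma LMC_bcontfun: "LMC \<subseteq> bcontfun"
  by (auto simp: LMC_def)

lemma LMC_iff: "f \<in> LMC \<longleftrightarrow> f \<in> bcontfun \<and> (\<forall>\<mu>\<in>spectrum bcontfun. continuous_on UNIV (T_op \<mu> f))"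
  by (simp add: LMC_def T_op_def)

lemma left_invariant_bcontfun:
  "left_translation_invariant (bcontfun :: ('a::semitopological_semigroup \<Rightarrow> complex) set)"
  by (simp add: left_translation_invariant_def left_translate_bcontfun)

lemma LMC_const: "(\<lambda>s. c) \<in> LMC"
  by (simp add: LMC_iff const_bcontfun T_op_const[OF _ const_bcontfun])

lemma subalgebra_LMC: "subalgebra (LMC :: ('a::semitopological_semigroup \<Rightarrow> complex) set)"
proof -
  note inv = left_invariant_bcontfun[where 'a = 'a]
  have "(\<lambda>s. f s + g s) \<in> LMC" if "f \<in> LMC" "g \<in> LMC" for f g :: "'a \<Rightarrow> complex"
    using that by (auto simp: LMC_iff plus_cont T_op_add[OF _ inv] intro: continuous_on_add)
  moreover have mult: "(\<lambda>s. f s * g s) \<in> LMC" if "f \<in> LMC" "g \<in> LMC" for f g :: "'a \<Rightarrow> complex"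
    using that by (auto simp: LMC_iff bcontfun_mult T_op_mult[OF _ inv] intro: continuous_on_mult)
  ultimately show ?thesis
    using LMC_bcontfun LMC_const mult[OF LMC_const] by (auto simp: subalgebra_def)
qed

lemma left_invariant_LMC:
  "left_translation_invariant (LMC :: ('a::semitopological_semigroup \<Rightarrow> complex) set)"
  unfolding left_translation_invariant_def
proof (intro allI ballI)
  fix s and f :: "'a \<Rightarrow> complex" assume "f \<in> LMC"
  moreover have "continuous_on UNIV (left_translate s h)" if "continuous_on UNIV h" for h :: "'a \<Rightarrow> complex"
    unfolding left_translate_def o_def
    by (rule continuous_on_compose2[OF that continuous_on_left_translation]) simp
  ultimately show "left_translate s f \<in> LMC"
    by (auto simp: LMC_iff left_translate_bcontfun T_op_left_translate)
qed

lemma continuous_on_uniform_approx: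
  fixes f :: "'a::topological_space \<Rightarrow> complex"
  assumes "\<And>e. e > 0 \<Longrightarrow> \<exists>g. continuous_on UNIV g \<and> (\<forall>s. cmod (f s - g s) \<le> e)"
  shows "continuous_on UNIV f"
proof -
  have "\<exists>g. continuous_on UNIV g \<and> (\<forall>s. cmod (f s - g s) \<le> 1 / real (Suc n))" for n
    by (rule assms) simp
  then obtain g where g: "\<And>n. continuous_on UNIV (g n)" "\<And>n s. cmod (f s - g n s) \<le> 1 / real (Suc n)"
    by metis
  have "uniform_limit UNIV g f sequentially"
  proof (rule uniform_limitI)
    fix e :: real assume "e > 0"
    then obtain N where N: "1 / real (Suc N) < e" using nat_approx_posE by blast
    have "dist (g n s) (f s) < e" if "n \<ge> N" for n s
    proof -
      have "1 / real (Suc n) \<le> 1 / real (Suc N)" using that by (intro divide_left_mono) auto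
      then show ?thesis using g(2)[of s n] N by (simp add: dist_norm norm_minus_commute)
    qed
    then show "\<forall>\<^sub>F n in sequentially. \<forall>s\<in>UNIV. dist (g n s) (f s) < e"
      by (auto simp: eventually_sequentially)
  qed
  then show ?thesis
    by (rule uniform_limit_theorem[rotated]) (simp_all add: g)
qed

text \<open>T_\<mu> is contractive on C(S): if g in LMC(S) is uniformly close to f, the continuous
  function T_\<mu> g is equally close to T_\<mu> f, which is therefore a uniform limit of continuous
  functions.\<close>

lemma norm_closed_LMC: "norm_closed (LMC :: ('a::semitopological_semigroup \<Rightarrow> complex) set)"
  unfolding norm_closed_iff
proof
  fix f :: "'a \<Rightarrow> complex" assume f: "f \<in> norm_closure LMC"
  have fb: "f \<in> bcontfun" using f by (simp add: norm_closure_iff[OF LMC_bcontfun])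
  have "continuous_on UNIV (T_op \<mu> f)" if \<mu>: "\<mu> \<in> spectrum bcontfun" for \<mu>
  proof (rule continuous_on_uniform_approx)
    fix e :: real assume "e > 0"
    then obtain g where g: "g \<in> LMC" "\<And>s. cmod (f s - g s) \<le> e"
      using norm_closure_approx[OF f LMC_bcontfun] by blast
    have gb: "g \<in> bcontfun" using g LMC_bcontfun by blast
    have "cmod (T_op \<mu> (\<lambda>s. f s - g s) s) \<le> e" for s
      using unital_cstar_bcontfun fb gb g(2) \<mu>
      by (intro T_op_norm_le[of bcontfun] left_invariant_bcontfun minus_cont)
        (auto simp: unital_cstar_subalgebra_def)
    then have "cmod (T_op \<mu> f s - T_op \<mu> g s) \<le> e" for s
      by (simp add: T_op_diff[OF subalgebra_bcontfun \<mu> left_invariant_bcontfun fb gb])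
    then show "\<exists>h. continuous_on UNIV h \<and> (\<forall>s. cmod (T_op \<mu> f s - h s) \<le> e)"
      using g(1) \<mu> by (auto simp: LMC_iff)
  qed
  with fb show "f \<in> LMC" by (auto simp: LMC_iff)
qed

text \<open>For a unimodular function no involution is needed to see that its conjugate is mapped to
  the conjugate: both are the multiplicative inverse.\<close>

lemma T_op_inverse:
  assumes "\<mu> \<in> spectrum A" "(\<lambda>s. 1) \<in> A" "left_translation_invariant A" "f \<in> A" "g \<in> A"
    and "\<And>s. f s * g s = 1"
  shows "T_op \<mu> g s = inverse (T_op \<mu> f s)"
proof -
  have "T_op \<mu> f s * T_op \<mu> g s = 1"
    using spectrum_inverse[OF assms(1,2), of "left_translate s f" "left_translate s g"] assms(3-)
    by (auto simp: T_op_def left_translation_invariant_def)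
  then show ?thesis by (rule inverse_unique[symmetric])
qed

text \<open>T_\<mu> of the conjugate is the reciprocal of T_\<mu> f, a continuous function without
  zeros. Treating unimodular functions suffices, since conjugates are taken of generators first and
  the generated algebra inherits the property.\<close>

lemma LMC_cnj:
  assumes f: "f \<in> LMC" and uni: "\<And>s. cmod (f s) = 1"
  shows "(\<lambda>s. cnj (f s)) \<in> LMC"
  unfolding LMC_iff
proof (intro conjI ballI)
  have fb: "f \<in> bcontfun" using f LMC_bcontfun by blast
  then show b: "(\<lambda>s. cnj (f s)) \<in> bcontfun" by (rule bcontfun_cnj)
  fix \<mu> assume \<mu>: "\<mu> \<in> spectrum (bcontfun :: ('a \<Rightarrow> complex) set)"
  have one: "f s * cnj (f s) = 1" for s by (simp add: complex_norm_square[symmetric] uni)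
  have inv: "T_op \<mu> (\<lambda>s. cnj (f s)) s = inverse (T_op \<mu> f s)" for s
    by (rule T_op_inverse[OF \<mu> const_bcontfun left_invariant_bcontfun fb b one])
  have "T_op \<mu> f s * T_op \<mu> (\<lambda>s. cnj (f s)) s = 1" for s
    using T_op_mult[OF \<mu> left_invariant_bcontfun fb b] T_op_const[OF \<mu> const_bcontfun, of 1]
    by (simp add: one fun_eq_iff)
  then have "T_op \<mu> f s \<noteq> 0" for s by (metis mult_zero_left zero_neq_one)
  moreover have "continuous_on UNIV (T_op \<mu> f)" using f \<mu> by (auto simp: LMC_iff)
  ultimately show "continuous_on UNIV (T_op \<mu> (\<lambda>s. cnj (f s)))"
    unfolding inv by (intro continuous_on_inverse) auto
qed

section \<open>The closed algebra generated by a \<open>\<Sigma>\<close>-stable set\<close>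

text \<open>\<open>G\<close> stands for one F_k or a union of them. Each property of the generators
  climbs in two stages: to the algebra \<open>H\<close>, because the functions having it form a
  subalgebra, and then to the closure \<open>V\<close> by uniform approximation.\<close>

lemma
  fixes G :: "('a::semitopological_semigroup \<Rightarrow> complex) set"
  assumes G_LMC: "G \<subseteq> LMC" and G_one: "(\<lambda>s. 1) \<in> G"
    and G_cnj: "\<And>f. f \<in> G \<Longrightarrow> (\<lambda>s. cnj (f s)) \<in> G"
    and G_left: "\<And>f s. f \<in> G \<Longrightarrow> left_translate s f \<in> G"
    and G_T: "\<And>f \<mu>. f \<in> G \<Longrightarrow> \<mu> \<in> spectrum LMC \<Longrightarrow> T_op \<mu> f \<in> G"
  shows m_admissible_closure: "m_admissible (norm_closure (subalgebra hull G))" (is "m_admissible ?V")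
    and closure_subset_distal: "(\<And>f \<epsilon>. f \<in> G \<Longrightarrow> \<epsilon> \<in> Sigma_LMC \<Longrightarrow> compose LMC \<epsilon> \<epsilon> = \<epsilon> \<Longrightarrow> \<epsilon> f = f)
      \<Longrightarrow> norm_closure (subalgebra hull G) \<subseteq> distal_functions"
proof -
  define H where "H = subalgebra hull G"
  define V where "V = norm_closure H"
  have Gb: "G \<subseteq> bcontfun" using G_LMC LMC_bcontfun by blast
  have H: "subalgebra H" unfolding H_def by (rule subalgebra_hull[OF Gb])
  have GH: "G \<subseteq> H" unfolding H_def by (rule hull_subset)
  have hull: "H \<subseteq> X" if "G \<subseteq> X" "subalgebra X" for X
    unfolding H_def using that by (rule hull_minimal[where S = subalgebra])
  have HL: "H \<subseteq> LMC" by (rule hull[OF G_LMC subalgebra_LMC])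
  have Hb: "H \<subseteq> bcontfun" using HL LMC_bcontfun by blast
  have HV: "H \<subseteq> V" unfolding V_def by (rule norm_closure_superset[OF Hb])
  have VL: "V \<subseteq> LMC" unfolding V_def by (rule norm_closure_minimal[OF HL norm_closed_LMC])
  have Vb: "V \<subseteq> bcontfun" using VL LMC_bcontfun by blast
  have V: "subalgebra V" unfolding V_def by (rule subalgebra_norm_closure[OF H])
  have V_one: "(\<lambda>s. 1) \<in> V" using G_one GH HV by blast
  have V_closed: "norm_closed V" unfolding V_def by (rule norm_closed_norm_closure)
  have V_I: "f \<in> V" if "f \<in> bcontfun" "\<And>e. e > 0 \<Longrightarrow> \<exists>g\<in>H. \<forall>s. cmod (f s - g s) \<le> e" for f
    using that norm_closure_iff[OF Hb] unfolding V_def by blast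
  have V_E: "\<exists>g\<in>H. \<forall>s. cmod (f s - g s) \<le> e" if "f \<in> V" "e > 0" for f e
    using that norm_closure_iff[OF Hb] unfolding V_def by blast

  \<comment> \<open>Induction over the hull: the set on the right is a subalgebra containing
    \<open>G\<close>. The same device serves translations, T_\<mu> and fixed points below.\<close>
  have "H \<subseteq> {f \<in> bcontfun. (\<lambda>s. cnj (f s)) \<in> H}"
    by (rule hull) (use H Hb Gb G_cnj GH subalgebra_bcontfun in \<open>auto simp: subalgebra_def\<close>)
  then have H_cnj: "(\<lambda>s. cnj (f s)) \<in> H" if "f \<in> H" for f using that by blast
  have V_cnj: "(\<lambda>s. cnj (f s)) \<in> V" if f: "f \<in> V" for f
  proof (rule V_I)
    show "(\<lambda>s. cnj (f s)) \<in> bcontfun" using f Vb bcontfun_cnj by blast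
    fix e :: real assume "e > 0"
    then obtain g where g: "g \<in> H" "\<And>s. cmod (f s - g s) \<le> e" using V_E[OF f] by blast
    have "cmod (cnj (f s) - cnj (g s)) \<le> e" for s
      using g(2)[of s] by (metis complex_cnj_diff complex_mod_cnj)
    then show "\<exists>g\<in>H. \<forall>s. cmod (cnj (f s) - g s) \<le> e"
      using H_cnj[OF g(1)] by (intro bexI[of _ "\<lambda>s. cnj (g s)"]) auto
  qed

  have "H \<subseteq> {f \<in> bcontfun. left_translate s f \<in> H}" for s
    by (rule hull) (use H Hb Gb G_left GH subalgebra_bcontfun in
        \<open>auto simp: subalgebra_def left_translate_def o_def\<close>)
  then have H_left: "left_translate s f \<in> H" if "f \<in> H" for f s using that by blast
  have V_left: "left_translation_invariant V"
    unfolding left_translation_invariant_def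
  proof (intro allI ballI)
    fix s f assume f: "f \<in> V"
    show "left_translate s f \<in> V"
    proof (rule V_I)
      show "left_translate s f \<in> bcontfun" using f Vb left_translate_bcontfun by blast
      fix e :: real assume "e > 0"
      then obtain g where g: "g \<in> H" "\<And>s. cmod (f s - g s) \<le> e" using V_E[OF f] by blast
      then show "\<exists>g\<in>H. \<forall>t. cmod (left_translate s f t - g t) \<le> e"
        using H_left[OF g(1), of s] by (intro bexI[of _ "left_translate s g"]) auto
    qed
  qed

  have V_cstar: "unital_cstar_subalgebra V"
    using V V_one V_cnj V_closed by (auto simp: unital_cstar_subalgebra_def)
  have V_T: "T_op \<mu> f \<in> V" if \<mu>: "\<mu> \<in> spectrum V" and f: "f \<in> V" for \<mu> f
  proof -
    \<comment> \<open>\<mu> is defined only on \<open>V\<close>, and its extension has two uses: as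
      a character of C(S) it makes T_\<mu> f continuous, since f is in LMC(S), and restricted to
      LMC(S) it makes T_\<mu> preserve \<open>G\<close>.\<close>
    obtain \<nu> where \<nu>: "\<nu> \<in> spectrum bcontfun" "\<And>f. f \<in> V \<Longrightarrow> \<nu> f = \<mu> f"
      using spectrum_extend[OF V_cstar \<mu>] by blast
    have \<nu>L: "restrict \<nu> LMC \<in> spectrum LMC"
      by (rule spectrum_restrict[OF subalgebra_LMC LMC_const LMC_bcontfun \<nu>(1)])
    have eq: "T_op \<nu> f = T_op \<mu> f" "T_op (restrict \<nu> LMC) f = T_op \<mu> f" if "f \<in> V" for f
      using that V_left VL \<nu>(2) by (auto simp: T_op_def left_translation_invariant_def fun_eq_iff subset_iff)
    note add = T_op_add[OF \<mu> V_left] and scale = T_op_scale[OF \<mu> V_left] and mult = T_op_mult[OF \<mu> V_left]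
    have zero: "T_op \<mu> (\<lambda>s. 0) = (\<lambda>s. 0)" by (rule T_op_const[OF \<mu> V_one])
    have G_T': "T_op \<mu> f \<in> H" if "f \<in> G" for f
    proof -
      have "f \<in> V" using that GH HV by blast
      then have "T_op \<mu> f \<in> G" using G_T[OF that \<nu>L] by (simp only: eq(2))
      then show ?thesis using GH by blast
    qed
    have "H \<subseteq> {f \<in> H. T_op \<mu> f \<in> H}"
      by (rule hull) (use H Hb HV GH G_T' zero in \<open>auto simp: subalgebra_def add scale mult subset_iff\<close>)
    then have H_T: "T_op \<mu> f \<in> H" if "f \<in> H" for f using that by blast
    show ?thesis
    proof (rule V_I)
      obtain b where b: "\<And>s. cmod (f s) \<le> b" using bcontfun_bounded f Vb by blast
      have "continuous_on UNIV (T_op \<nu> f)" using f VL \<nu>(1) by (auto simp: LMC_iff)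
      then show "T_op \<mu> f \<in> bcontfun"
        using T_op_norm_le[OF V V_one V_closed \<mu> V_left f b]
        by (intro bcontfun_normI[where b = b]) (simp_all add: eq(1)[OF f])
      fix e :: real assume "e > 0"
      then obtain g where g: "g \<in> H" "\<And>s. cmod (f s - g s) \<le> e" using V_E[OF f] by blast
      have gV: "g \<in> V" using g HV by blast
      have "cmod (T_op \<mu> f s - T_op \<mu> g s) \<le> e" for s
        using T_op_norm_le[OF V V_one V_closed \<mu> V_left subalgebra_diff[OF V f gV] g(2), of s]
          T_op_diff[OF V \<mu> V_left f gV] by simp
      then show "\<exists>g\<in>H. \<forall>s. cmod (T_op \<mu> f s - g s) \<le> e" using H_T[OF g(1)] by blast
    qed
  qed
  show "m_admissible ?V"
    using V_cstar V_left V_T unfolding m_admissible_def V_def H_def by blast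

  assume G_fix: "\<And>f \<epsilon>. f \<in> G \<Longrightarrow> \<epsilon> \<in> Sigma_LMC \<Longrightarrow> compose LMC \<epsilon> \<epsilon> = \<epsilon> \<Longrightarrow> \<epsilon> f = f"
  \<comment> \<open>The opposite passage: an element of Sigma acts on \<open>V\<close> through a
    character of \<open>V\<close>, so the stability and contractivity just obtained apply to
    it.\<close>
  have restr: "restrict \<mu> V \<in> spectrum V" and restr_T: "\<And>f. f \<in> V \<Longrightarrow> T_op (restrict \<mu> V) f = T_op \<mu> f"
    if "\<mu> \<in> spectrum LMC" for \<mu>
    using spectrum_restrict[OF V V_one VL that] V_left
    by (auto simp: T_op_def left_translation_invariant_def fun_eq_iff)
  have V_fix: "\<epsilon> f = f" if \<epsilon>: "\<epsilon> \<in> Sigma_LMC" "compose LMC \<epsilon> \<epsilon> = \<epsilon>" and f: "f \<in> V" for \<epsilon> f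
  proof -
    obtain \<mu> where \<mu>L: "\<mu> \<in> spectrum LMC" and \<epsilon>\<mu>: "\<epsilon> = restrict (T_op \<mu>) LMC"
      using \<epsilon>(1) by (auto simp: Sigma_LMC_def)
    define \<nu> where "\<nu> = restrict \<mu> V"
    have \<nu>: "\<nu> \<in> spectrum V" unfolding \<nu>_def by (rule restr[OF \<mu>L])
    have \<epsilon>\<nu>: "\<epsilon> f = T_op \<nu> f" if "f \<in> V" for f
      using restr_T[OF \<mu>L that] that VL by (auto simp: \<epsilon>\<mu> \<nu>_def)
    note add = T_op_add[OF \<nu> V_left] and scale = T_op_scale[OF \<nu> V_left] and mult = T_op_mult[OF \<nu> V_left]
    have zero: "T_op \<nu> (\<lambda>s. 0) = (\<lambda>s. 0)" by (rule T_op_const[OF \<nu> V_one])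
    have G_fix': "T_op \<nu> f = f" if "f \<in> G" for f
      using G_fix[OF that \<epsilon>] \<epsilon>\<nu>[of f] that GH HV by auto
    have "H \<subseteq> {f \<in> H. T_op \<nu> f = f}"
      by (rule hull) (use H Hb HV GH G_fix' zero in \<open>auto simp: subalgebra_def add scale mult subset_iff\<close>)
    then have H_fix: "T_op \<nu> f = f" if "f \<in> H" for f using that by blast
    have "T_op \<nu> f s = f s" for s
    proof -
      have "cmod (T_op \<nu> f s - f s) \<le> 0 + d" if "d > 0" for d
      proof -
        have "d / 2 > 0" using that by simp
        then obtain g where g: "g \<in> H" "\<And>s. cmod (f s - g s) \<le> d / 2" using V_E[OF f] by blast
        have gV: "g \<in> V" using g HV by blast
        have "cmod (T_op \<nu> f s - g s) \<le> d / 2"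
          using T_op_norm_le[OF V V_one V_closed \<nu> V_left subalgebra_diff[OF V f gV] g(2), of s]
            T_op_diff[OF V \<nu> V_left f gV] H_fix[OF g(1)] by simp
        with g(2)[of s] show ?thesis
          using norm_triangle_ineq4[of "T_op \<nu> f s - g s" "f s - g s"] by simp
      qed
      then show ?thesis using field_le_epsilon[of "cmod (T_op \<nu> f s - f s)" 0] by auto
    qed
    then show ?thesis using \<epsilon>\<nu>[OF f] by auto
  qed
  have "V \<subseteq> distal_functions"
  proof
    fix f assume f: "f \<in> V"
    \<comment> \<open>Since \<sigma> f stays in \<open>V\<close>, the identity \<epsilon>(\<sigma>
      f) = \<sigma> f is an instance of \<open>V_fix\<close>.\<close>
    have "\<sigma> f \<in> V" if \<sigma>: "\<sigma> \<in> Sigma_LMC" for \<sigma>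
    proof -
      obtain \<mu> where \<mu>: "\<mu> \<in> spectrum LMC" "\<sigma> = restrict (T_op \<mu>) LMC"
        using \<sigma> by (auto simp: Sigma_LMC_def)
      then show ?thesis using V_T[OF restr[OF \<mu>(1)] f] restr_T[OF \<mu>(1) f] f VL by auto
    qed
    then show "f \<in> distal_functions" using V_fix f VL by (auto simp: distal_functions_def)
  qed
  then show "?V \<subseteq> distal_functions" by (simp add: V_def H_def)
qed

section \<open>The groups \<open>F_set k\<close>\<close>

text \<open>On LMC(S) the elements of Sigma are the operators T_\<mu>, so the multipliers can be
  indexed by characters and \<open>restrict\<close> disappears from the inductions.\<close>

lemma F_set_Suc_iff:
  "f \<in> F_set (Suc k) \<longleftrightarrow> f \<in> LMC \<and> (\<forall>s. cmod (f s) = 1) \<and>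
    (\<forall>\<mu>\<in>spectrum LMC. \<exists>g\<in>F_set k. T_op \<mu> f = (\<lambda>s. g s * f s))"
proof -
  have "(\<forall>\<sigma>\<in>Sigma_LMC. P (\<sigma> f)) \<longleftrightarrow> (\<forall>\<mu>\<in>spectrum LMC. P (T_op \<mu> f))" if "f \<in> LMC" for P
    using that by (fastforce simp: Sigma_LMC_def)
  from this[of "\<lambda>h. \<exists>g\<in>F_set k. h = (\<lambda>s. g s * f s)"] show ?thesis by auto
qed

lemma F_set_LMC: "F_set k \<subseteq> LMC"
  by (cases k) (use LMC_const in \<open>auto simp del: F_set.simps(2) simp: F_set_Suc_iff\<close>)

lemma F_set_norm: "f \<in> F_set k \<Longrightarrow> cmod (f s) = 1"
  by (cases k) (auto simp del: F_set.simps(2) simp: F_set_Suc_iff)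

text \<open>Constants are fixed by every T_\<mu>, so they have multiplier 1. Higher up, the
  inclusion for the multipliers gives the inclusion one level above.\<close>

lemma F_set_Suc_mono: "F_set k \<subseteq> F_set (Suc k)"
proof (induction k)
  case 0
  have "f \<in> F_set (Suc 0)" if f: "f \<in> F_set 0" for f :: "'a \<Rightarrow> complex"
    unfolding F_set_Suc_iff
  proof (intro conjI ballI allI)
    show "f \<in> LMC" "cmod (f s) = 1" for s using f F_set_LMC F_set_norm by blast+
    fix \<mu> assume "\<mu> \<in> spectrum (LMC :: ('a \<Rightarrow> complex) set)"
    then have "T_op \<mu> f = f" using f T_op_const[OF _ LMC_const] by auto
    then show "\<exists>g\<in>F_set 0. T_op \<mu> f = (\<lambda>s. g s * f s)"
      by (intro bexI[of _ "\<lambda>s. 1"]) (auto intro: exI[of _ 1])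
  qed
  then show ?case by blast
next
  case (Suc k)
  show ?case
  proof
    fix f :: "'a \<Rightarrow> complex" assume "f \<in> F_set (Suc k)"
    with Suc show "f \<in> F_set (Suc (Suc k))"
      unfolding F_set_Suc_iff[of _ "Suc k"] F_set_Suc_iff[of f k] by (meson subset_iff)
  qed
qed

lemma F_set_mono: "j \<le> k \<Longrightarrow> F_set j \<subseteq> F_set k"
  by (rule lift_Suc_mono_le[of F_set]) (rule F_set_Suc_mono)

lemma F_set_one: "(\<lambda>s. 1) \<in> F_set k"
proof -
  have "(\<lambda>s. 1) \<in> F_set 0" by (auto intro: exI[of _ 1])
  then show ?thesis by (rule subsetD[OF F_set_mono[OF le0]])
qed

text \<open>T_\<mu> is multiplicative, so the multiplier of a product is the product of the
  multipliers, which lies one level down.\<close>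

lemma F_set_mult: "f \<in> F_set k \<Longrightarrow> g \<in> F_set k \<Longrightarrow> (\<lambda>s. f s * g s) \<in> F_set k"
proof (induction k arbitrary: f g)
  case 0
  then obtain c d where "cmod c = 1" "f = (\<lambda>s. c)" "cmod d = 1" "g = (\<lambda>s. d)" by auto
  then show ?case by (auto simp: norm_mult intro!: exI[of _ "c * d"])
next
  case (Suc k)
  have fg: "f \<in> LMC" "g \<in> LMC" using Suc.prems F_set_LMC by blast+
  show ?case
    unfolding F_set_Suc_iff
  proof (intro conjI ballI allI)
    show "(\<lambda>s. f s * g s) \<in> LMC" using fg subalgebra_LMC by (auto simp: subalgebra_def)
    show "cmod (f s * g s) = 1" for s
      using Suc.prems[THEN F_set_norm] by (simp add: norm_mult)
    fix \<mu> assume \<mu>: "\<mu> \<in> spectrum (LMC :: ('a \<Rightarrow> complex) set)"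
    obtain u v where uv: "u \<in> F_set k" "v \<in> F_set k"
      "T_op \<mu> f = (\<lambda>s. u s * f s)" "T_op \<mu> g = (\<lambda>s. v s * g s)"
      using Suc.prems \<mu> unfolding F_set_Suc_iff by blast
    have "T_op \<mu> (\<lambda>s. f s * g s) = (\<lambda>s. (u s * v s) * (f s * g s))"
      using T_op_mult[OF \<mu> left_invariant_LMC fg] uv(3,4) by (simp add: fun_eq_iff)
    then show "\<exists>h\<in>F_set k. T_op \<mu> (\<lambda>s. f s * g s) = (\<lambda>s. h s * (f s * g s))"
      by (intro bexI[of _ "\<lambda>s. u s * v s"] Suc.IH uv)
  qed
qed

text \<open>For unimodular functions conjugation is inversion, so the multiplier of the conjugate is
  the conjugate of the multiplier.\<close>

lemma F_set_cnj: "f \<in> F_set k \<Longrightarrow> (\<lambda>s. cnj (f s)) \<in> F_set k"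
proof (induction k arbitrary: f)
  case 0
  then obtain c where "cmod c = 1" "f = (\<lambda>s. c)" by auto
  then show ?case by (auto intro!: exI[of _ "cnj c"])
next
  case (Suc k)
  have f: "f \<in> LMC" "\<And>s. cmod (f s) = 1" using Suc.prems F_set_LMC F_set_norm by blast+
  have cnj_inverse: "cnj z = inverse z" if "cmod z = 1" for z
  proof -
    have "z * cnj z = 1" using that by (simp add: complex_norm_square[symmetric])
    then show ?thesis by (rule inverse_unique[symmetric])
  qed
  show ?case
    unfolding F_set_Suc_iff
  proof (intro conjI ballI allI)
    show c: "(\<lambda>s. cnj (f s)) \<in> LMC" by (rule LMC_cnj[OF f])
    show "cmod (cnj (f s)) = 1" for s by (simp add: f)
    fix \<mu> assume \<mu>: "\<mu> \<in> spectrum (LMC :: ('a \<Rightarrow> complex) set)"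
    obtain u where u: "u \<in> F_set k" "T_op \<mu> f = (\<lambda>s. u s * f s)"
      using Suc.prems \<mu> unfolding F_set_Suc_iff by blast
    have "T_op \<mu> (\<lambda>s. cnj (f s)) s = cnj (u s) * cnj (f s)" for s
    proof -
      have "T_op \<mu> (\<lambda>s. cnj (f s)) s = inverse (T_op \<mu> f s)"
        by (rule T_op_inverse[OF \<mu> LMC_const left_invariant_LMC f(1) c])
          (simp add: complex_norm_square[symmetric] f)
      then show ?thesis
        using F_set_norm[OF u(1), of s] f(2)[of s] by (simp add: u(2) cnj_inverse)
    qed
    then show "\<exists>h\<in>F_set k. T_op \<mu> (\<lambda>s. cnj (f s)) = (\<lambda>s. h s * cnj (f s))"
      using Suc.IH[OF u(1)] by (intro bexI[of _ "\<lambda>s. cnj (u s)"]) auto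
  qed
qed

text \<open>T_\<mu> commutes with translation, so the multiplier is translated along with the
  function.\<close>

lemma F_set_left_translate: "f \<in> F_set k \<Longrightarrow> left_translate t f \<in> F_set k"
proof (induction k arbitrary: f)
  case 0
  then show ?case by (auto simp: left_translate_def)
next
  case (Suc k)
  show ?case
    unfolding F_set_Suc_iff
  proof (intro conjI ballI allI)
    show "left_translate t f \<in> LMC"
      using Suc.prems left_invariant_LMC unfolding left_translation_invariant_def F_set_Suc_iff by blast
    show "cmod (left_translate t f s) = 1" for s
      using F_set_norm[OF Suc.prems] by simp
    fix \<mu> assume \<mu>: "\<mu> \<in> spectrum (LMC :: ('a \<Rightarrow> complex) set)"
    obtain u where u: "u \<in> F_set k" "T_op \<mu> f = (\<lambda>s. u s * f s)"
      using Suc.prems \<mu> unfolding F_set_Suc_iff by blast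
    then have "T_op \<mu> (left_translate t f) = (\<lambda>s. left_translate t u s * left_translate t f s)"
      by (simp add: T_op_left_translate fun_eq_iff)
    then show "\<exists>h\<in>F_set k. T_op \<mu> (left_translate t f) = (\<lambda>s. h s * left_translate t f s)"
      using Suc.IH[OF u(1)] by blast
  qed
qed

text \<open>For k > 0 the image is u f with \<open>u\<close> one level lower; monotonicity puts
  \<open>u\<close> in the same set as \<open>f\<close>, and that set is closed under
  products.\<close>

lemma F_set_T_op:
  assumes "f \<in> F_set k" and \<mu>: "\<mu> \<in> spectrum LMC"
  shows "T_op \<mu> f \<in> F_set k"
proof (cases k)
  case 0
  then show ?thesis using assms T_op_const[OF \<mu> LMC_const] by auto
next
  case (Suc j)
  then obtain u where u: "u \<in> F_set j" "T_op \<mu> f = (\<lambda>s. u s * f s)"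
    using assms unfolding Suc F_set_Suc_iff by blast
  then show ?thesis using F_set_mult[of u k f] F_set_Suc_mono[of j] assms(1) Suc by auto
qed

lemma F_set_idempotent_fixed:
  assumes "\<epsilon> \<in> Sigma_LMC" "compose LMC \<epsilon> \<epsilon> = \<epsilon>"
  shows "f \<in> F_set k \<Longrightarrow> \<epsilon> f = f"
proof (induction k arbitrary: f)
  case 0
  then obtain c where "f = (\<lambda>s. c)" by auto
  moreover have "restrict (T_op \<mu>) LMC (\<lambda>s. c) = (\<lambda>s. c)" if "\<mu> \<in> spectrum LMC" for \<mu>
    unfolding restrict_apply'[OF LMC_const] by (rule T_op_const[OF that LMC_const])
  ultimately show ?case using assms(1) unfolding Sigma_LMC_def by blast
next
  case (Suc k)
  obtain \<mu> where \<mu>: "\<mu> \<in> spectrum LMC" and \<epsilon>: "\<epsilon> = restrict (T_op \<mu>) LMC"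
    using assms(1) by (auto simp: Sigma_LMC_def)
  have \<epsilon>T: "\<epsilon> g = T_op \<mu> g" if "g \<in> LMC" for g using that by (simp add: \<epsilon>)
  have f: "f \<in> LMC" using Suc.prems F_set_LMC by blast
  obtain h where h: "h \<in> F_set k" "T_op \<mu> f = (\<lambda>s. h s * f s)"
    using Suc.prems \<mu> unfolding F_set_Suc_iff by blast
  have hL: "h \<in> LMC" using h F_set_LMC by blast
  have \<epsilon>f: "\<epsilon> f = (\<lambda>s. h s * f s)" using \<epsilon>T[OF f] h(2) by simp
  have hf: "(\<lambda>s. h s * f s) \<in> LMC" using f hL subalgebra_LMC by (auto simp: subalgebra_def)
  have "T_op \<mu> h = h" using Suc.IH[OF h(1)] \<epsilon>T[OF hL] by simp
  then have "\<epsilon> (\<epsilon> f) = (\<lambda>s. h s * (h s * f s))"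
    using T_op_mult[OF \<mu> left_invariant_LMC hL f] \<epsilon>T[OF hf] by (simp add: \<epsilon>f h(2))
  moreover have "\<epsilon> (\<epsilon> f) = \<epsilon> f" using assms(2) f by (metis compose_eq)
  ultimately have eq: "h s * (h s * f s) = h s * f s" for s by (metis \<epsilon>f)
  \<comment> \<open>Both values have modulus 1, so h s * f s is nonzero and can be
    cancelled.\<close>
  have "h s = 1" for s
    using eq[of s] F_set_norm[OF h(1), of s] F_set_norm[OF Suc.prems, of s] by auto
  then show ?case by (simp add: \<epsilon>f)
qed

text \<open>A general index set treats W_k and W together. Every property required of the generators
  concerns one function at a time, so it survives arbitrary unions; a nonempty \<open>K\<close>
  supplies the constant 1.\<close>

lemma
  assumes K: "K \<noteq> {}"
  shows m_admissible_closure_F_set: "m_admissible (norm_closure (subalgebra hull (\<Union>k\<in>K. F_set k)))"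
    and closure_F_set_distal: "norm_closure (subalgebra hull (\<Union>k\<in>K. F_set k)) \<subseteq> distal_functions"
proof -
  let ?G = "\<Union>k\<in>K. F_set k"
  have 1: "?G \<subseteq> LMC" using F_set_LMC by blast
  have 2: "(\<lambda>s. 1) \<in> ?G" using K F_set_one by blast
  have 3: "(\<lambda>s. cnj (f s)) \<in> ?G" if "f \<in> ?G" for f using that F_set_cnj by blast
  have 4: "left_translate s f \<in> ?G" if "f \<in> ?G" for s f using that F_set_left_translate by blast
  have 5: "T_op \<mu> f \<in> ?G" if "f \<in> ?G" "\<mu> \<in> spectrum LMC" for f \<mu> using that F_set_T_op by blast
  have 6: "\<epsilon> f = f" if "f \<in> ?G" "\<epsilon> \<in> Sigma_LMC" "compose LMC \<epsilon> \<epsilon> = \<epsilon>" for f \<epsilon>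
    using that F_set_idempotent_fixed by blast
  show "m_admissible (norm_closure (subalgebra hull ?G))"
    by (rule m_admissible_closure[OF 1 2 3 4 5])
  show "norm_closure (subalgebra hull ?G) \<subseteq> distal_functions"
    by (rule closure_subset_distal[OF 1 2]) (fact 3 4 5 6)+
qed

theorem theorem3p5:
  shows "(\<forall>k\<ge>1. m_admissible (W_k k :: ('a::semitopological_semigroup \<Rightarrow> complex) set) \<and>
            (W_k k :: ('a \<Rightarrow> complex) set) \<subseteq> distal_functions) \<and>
         m_admissible (W :: ('a \<Rightarrow> complex) set) \<and>
         (W :: ('a \<Rightarrow> complex) set) \<subseteq> distal_functions"
proof (intro conjI allI impI)
  fix k :: nat
  show "m_admissible (W_k k :: ('a \<Rightarrow> complex) set)" "(W_k k :: ('a \<Rightarrow> complex) set) \<subseteq> distal_functions"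
    using m_admissible_closure_F_set[of "{k}"] closure_F_set_distal[of "{k}"] by (simp_all add: W_k_def)
  show "m_admissible (W :: ('a \<Rightarrow> complex) set)" "(W :: ('a \<Rightarrow> complex) set) \<subseteq> distal_functions"
    unfolding W_def by (rule m_admissible_closure_F_set closure_F_set_distal, blast)+
qed

end
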